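(* Let $r:\mathbb{R}^2\to\mathbb{R}$ be defined by $$r(y_1,y_2):=1+\frac14\bigl(\cos(2\pi y_1)-2\sin(2\pi y_1)\bigr)\sin(2\pi y_2),$$ and let $A:\mathbb{R}^2\to\mathbb{R}^{2\times2}$ be given by $$A(y_1,y_2):=\frac{1}{r(y_1,y_2)}\begin{pmatrix}1-\frac12\sin(2\pi y_1)\sin(2\pi y_2)&0\\0&1+\frac12\sin(2\pi y_1)\sin(2\pi y_2)\end{pmatrix}.$$ Then $A$ is $c$-bad. More precisely, $c_1^{11}(A)=c_1^{22}(A)=-\frac{1}{128\pi}$, and $c_j^{kl}(A)=0$ for all other $(j,k,l)\in\{1,2\}^3$.
   Context: Let $\mathbb{T}^n=\mathbb{R}^n/\mathbb{Z}^n$, $Y=[0,1]^n$, $\mathcal{S}^n_+$ the set of symmetric positive definite $n\times n$ matrices, $M:N=\sum_{i,j}M_{ij}N_{ij}$, and $e_j$ the $j$-th standard basis vector. For $A=(a_{ij})\in C^2(\mathbb{T}^n;\mathcal{S}^n_+)$ (viewed as a $\mathbb{Z}^n$-periodic function on $\mathbb{R}^n$): Invariant measure of $A$: the $Y$-periodic function $r_A:\mathbb{R}^n\to\mathbb{R}$ solving $-D^2:(Ar_A)=0$ (i.e. $-\sum_{i,j}\partial^2_{ij}(a_{ij}r_A)=0$) in $Y$, with $r_A>0$ and $\int_Y r_A=1$. Effective coefficient: $\bar A=(\bar a_{ij}):=\int_Y A\,r_A$. Corrector functions: $v^{kl}$ is the unique solution of $-A:D^2v^{kl}=a_{kl}-\bar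 a_{kl}$ in $Y$, $v^{kl}$ $Y$-periodic, $\int_Y v^{kl}=0$. Constants: $c_j^{kl}(A):=\int_Y (Ae_j\cdot\nabla v^{kl})\,r_A$ for $j,k,l\in\{1,\dots,n\}$. The matrix $A$ is called $c$-bad if $c_j^{kl}(A)\neq0$ for some $j,k,l\in\{1,\dots,n\}$. *)

theory Defs
  imports "HOL-Analysis.Analysis"
begin

definition Y :: "(real ^ 'n) set"
  where "Y = cbox 0 1"

text \<open>Invariance under the unit translations generates invariance under the lattice
  of all integer vectors.\<close>

definition Y_periodic :: "(real ^ 'n \<Rightarrow> 'b) \<Rightarrow> bool"
  where "Y_periodic f \<longleftrightarrow> (\<forall>y i. f (y + axis i 1) = f y)"

definition partial :: "'n \<Rightarrow> (real ^ 'n \<Rightarrow> real) \<Rightarrow> real ^ 'n \<Rightarrow> real"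
  where "partial i f y = frechet_derivative f (at y) (axis i 1)"

definition C1 :: "(real ^ 'n \<Rightarrow> real) \<Rightarrow> bool"
  where "C1 f \<longleftrightarrow> f differentiable_on UNIV \<and> (\<forall>i. continuous_on UNIV (partial i f))"

definition C2 :: "(real ^ 'n \<Rightarrow> real) \<Rightarrow> bool"
  where "C2 f \<longleftrightarrow> C1 f \<and> (\<forall>i. C1 (partial i f))"

definition grad :: "(real ^ 'n \<Rightarrow> real) \<Rightarrow> real ^ 'n \<Rightarrow> real ^ 'n"
  where "grad f y = (\<chi> i. partial i f y)"

definition hessian :: "(real ^ 'n \<Rightarrow> real) \<Rightarrow> real ^ 'n \<Rightarrow> real ^ 'n ^ 'n"
  where "hessian f y = (\<chi> i j. partial i (partial j f) y)"

definition frob :: "real ^ 'n ^ 'n \<Rightarrow> real ^ 'n ^ 'n \<Rightarrow> real"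
  where "frob M N = (\<Sum>i\<in>UNIV. \<Sum>j\<in>UNIV. M $ i $ j * N $ i $ j)"

definition sym_pos_def :: "real ^ 'n ^ 'n \<Rightarrow> bool"
  where "sym_pos_def M \<longleftrightarrow> transpose M = M \<and> (\<forall>x. x \<noteq> 0 \<longrightarrow> x \<bullet> (M *v x) > 0)"

text \<open>The class \<open>C\<^sup>2(T\<^sup>n; S\<^sup>n\<^sub>+)\<close>, with functions on the torus viewed as periodic functions.\<close>

definition C2_torus_spd :: "(real ^ 'n \<Rightarrow> real ^ 'n ^ 'n) set"
  where "C2_torus_spd = {A. Y_periodic A \<and> (\<forall>i j. C2 (\<lambda>y. A y $ i $ j)) \<and> (\<forall>y. sym_pos_def (A y))}"

text \<open>Solutions of \<open>-D\<^sup>2:(Ar) = 0\<close> and of the corrector equation are understood in the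
  classical sense. The periodic functions are determined on the whole space, so that the
  definite descriptions below pick out a function and not merely its restriction to \<open>Y\<close>.\<close>

definition is_invariant_measure :: "(real ^ 'n \<Rightarrow> real ^ 'n ^ 'n) \<Rightarrow> (real ^ 'n \<Rightarrow> real) \<Rightarrow> bool"
  where "is_invariant_measure A r \<longleftrightarrow>
    C2 r \<and> Y_periodic r \<and>
    (\<forall>y\<in>Y. - (\<Sum>i\<in>UNIV. \<Sum>j\<in>UNIV. partial i (partial j (\<lambda>z. A z $ i $ j * r z)) y) = 0) \<and>
    (\<forall>y. r y > 0) \<and> integral Y r = 1"

definition invariant_measure :: "(real ^ 'n \<Rightarrow> real ^ 'n ^ 'n) \<Rightarrow> real ^ 'n \<Rightarrow> real"
  where "invariant_measure A = (THE r. is_invariant_measure A r)"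

definition effective_coeff :: "(real ^ 'n \<Rightarrow> real ^ 'n ^ 'n) \<Rightarrow> real ^ 'n ^ 'n"
  where "effective_coeff A = integral Y (\<lambda>y. invariant_measure A y *\<^sub>R A y)"

definition is_corrector ::
  "(real ^ 'n \<Rightarrow> real ^ 'n ^ 'n) \<Rightarrow> 'n \<Rightarrow> 'n \<Rightarrow> (real ^ 'n \<Rightarrow> real) \<Rightarrow> bool"
  where "is_corrector A k l v \<longleftrightarrow>
    C2 v \<and> Y_periodic v \<and>
    (\<forall>y\<in>Y. - frob (A y) (hessian v y) = A y $ k $ l - effective_coeff A $ k $ l) \<and>
    integral Y v = 0"

definition corrector :: "(real ^ 'n \<Rightarrow> real ^ 'n ^ 'n) \<Rightarrow> 'n \<Rightarrow> 'n \<Rightarrow> real ^ 'n \<Rightarrow> real"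
  where "corrector A k l = (THE v. is_corrector A k l v)"

text \<open>\<open>c_const A j k l\<close> is \<open>c\<close> with lower index \<open>j\<close> and upper indices \<open>k l\<close>.\<close>

definition c_const :: "(real ^ 'n \<Rightarrow> real ^ 'n ^ 'n) \<Rightarrow> 'n \<Rightarrow> 'n \<Rightarrow> 'n \<Rightarrow> real"
  where "c_const A j k l =
    integral Y (\<lambda>y. ((A y *v axis j 1) \<bullet> grad (corrector A k l) y) * invariant_measure A y)"

definition c_bad :: "(real ^ 'n \<Rightarrow> real ^ 'n ^ 'n) \<Rightarrow> bool"
  where "c_bad A \<longleftrightarrow> A \<in> C2_torus_spd \<and> (\<exists>j k l. c_const A j k l \<noteq> 0)"

end

theory Submission
  imports Defs
begin

text \<open>Write \<open>A = diag(a, b) / r\<close> with \<open>a = 1 - s/2\<close>, \<open>b = 1 + s/2\<close> and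
  \<open>s = sin(2\<pi>y\<^sub>1) sin(2\<pi>y\<^sub>2)\<close>. Since \<open>\<partial>\<^sub>1\<^sub>1 a + \<partial>\<^sub>2\<^sub>2 b = 0\<close>, the function \<open>r\<close> is an
  invariant measure and the effective matrix is the identity. Any combination \<open>v\<close> of \<open>s\<close> and
  \<open>cos(2\<pi>y\<^sub>1) sin(2\<pi>y\<^sub>2)\<close> satisfies \<open>\<partial>\<^sub>1\<^sub>1 v = \<partial>\<^sub>2\<^sub>2 v = -4\<pi>\<^sup>2v\<close>, and \<open>a + b = 2\<close>, so
  \<open>r A : D\<^sup>2v = -8\<pi>\<^sup>2v\<close>; the right-hand sides of all corrector equations (times \<open>r\<close>) are of this
  form, which gives the correctors explicitly.

  Uniqueness of the invariant measure and of the correctors is an energy argument: if \<open>u\<close> is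
  periodic and solves the homogeneous equation, then \<open>a (\<partial>\<^sub>1u)\<^sup>2 + b (\<partial>\<^sub>2u)\<^sup>2\<close> is the divergence of
  a periodic field, so it integrates to zero and \<open>u\<close> is constant.\<close>

section \<open>Calculus of partial derivatives\<close>

lemma has_derivative_partial:
  fixes f :: "real ^ 'n \<Rightarrow> real"
  assumes "(f has_derivative D) (at y)"
  shows "partial i f y = D (axis i 1)"
  using frechet_derivative_at[OF assms] by (simp add: partial_def)

lemma C1_has_derivative:
  "C1 f \<Longrightarrow> (f has_derivative frechet_derivative f (at y)) (at y)"
  by (simp add: C1_def differentiable_on_def frechet_derivative_works[symmetric])

lemma C1_continuous: "C1 f \<Longrightarrow> continuous_on S f"
  by (metis C1_def continuous_on_subset differentiable_imp_continuous_on subset_UNIV)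

lemma C1_partial_continuous: "C1 f \<Longrightarrow> continuous_on S (partial i f)"
  by (metis C1_def continuous_on_subset subset_UNIV)

lemma C2_imp_C1: "C2 f \<Longrightarrow> C1 f"
  and C2_partial_C1: "C2 f \<Longrightarrow> C1 (partial i f)"
  by (simp_all add: C2_def)

lemma C1I:
  assumes "\<And>y. (f has_derivative D y) (at y)" "\<And>i. continuous_on UNIV (\<lambda>y. D y (axis i 1))"
  shows "C1 f"
proof -
  have "partial i f = (\<lambda>y. D y (axis i 1))" for i
    using has_derivative_partial[OF assms(1)] by blast
  with assms show ?thesis
    by (auto simp: C1_def differentiable_on_def intro: differentiableI)
qed

text \<open>The partial derivative rules are equations between functions, not pointwise ones, so
  that they rewrite under a second \<open>partial\<close>.\<close>

lemma partial_add:
  assumes "C1 f" "C1 g"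
  shows "partial i (\<lambda>y. f y + g y) = (\<lambda>y. partial i f y + partial i g y)"
  using has_derivative_partial[OF has_derivative_add[OF C1_has_derivative[OF assms(1)] C1_has_derivative[OF assms(2)]]]
  by (simp add: partial_def fun_eq_iff)

lemma partial_diff:
  assumes "C1 f" "C1 g"
  shows "partial i (\<lambda>y. f y - g y) = (\<lambda>y. partial i f y - partial i g y)"
  using has_derivative_partial[OF has_derivative_diff[OF C1_has_derivative[OF assms(1)] C1_has_derivative[OF assms(2)]]]
  by (simp add: partial_def fun_eq_iff)

lemma partial_mult:
  assumes "C1 f" "C1 g"
  shows "partial i (\<lambda>y. f y * g y) = (\<lambda>y. partial i f y * g y + f y * partial i g y)"
  using has_derivative_partial[OF has_derivative_mult[OF C1_has_derivative[OF assms(1)] C1_has_derivative[OF assms(2)]]]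
  by (simp add: partial_def fun_eq_iff)

lemma partial_const: "partial i (\<lambda>y. c) = (\<lambda>y. 0)"
  by (rule ext) (rule has_derivative_partial[OF has_derivative_const])

lemma partial_inverse:
  assumes "C1 f" "\<And>y. f y \<noteq> 0"
  shows "partial i (\<lambda>y. inverse (f y)) = (\<lambda>y. - partial i f y * (inverse (f y) * inverse (f y)))"
  using has_derivative_partial[OF Deriv.has_derivative_inverse[OF assms(2) C1_has_derivative[OF assms(1)]]]
  by (simp add: partial_def fun_eq_iff)

lemma C1_const: "C1 (\<lambda>y. c)"
  by (rule C1I[where D = "\<lambda>y h. 0"]) auto

lemma C1_add: "C1 f \<Longrightarrow> C1 g \<Longrightarrow> C1 (\<lambda>y. f y + g y)"
  using partial_add[of f g]
  by (auto simp: C1_def intro!: differentiable_on_add continuous_intros)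

lemma C1_diff: "C1 f \<Longrightarrow> C1 g \<Longrightarrow> C1 (\<lambda>y. f y - g y)"
  using partial_diff[of f g]
  by (auto simp: C1_def intro!: differentiable_on_diff continuous_intros)

lemma C1_mult: "C1 f \<Longrightarrow> C1 g \<Longrightarrow> C1 (\<lambda>y. f y * g y)"
  using partial_mult[of f g] C1_continuous[of f UNIV] C1_continuous[of g UNIV]
  by (auto simp: C1_def intro!: differentiable_on_mult continuous_intros)

lemma C1_inverse: "C1 f \<Longrightarrow> (\<And>y. f y \<noteq> 0) \<Longrightarrow> C1 (\<lambda>y. inverse (f y))"
  using partial_inverse[of f] C1_continuous[of f UNIV]
  by (auto simp: C1_def intro!: differentiable_on_inverse continuous_intros)

lemma C2_const: "C2 (\<lambda>y. c)"
  by (simp add: C2_def C1_const partial_const)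

lemma C2_add: "C2 f \<Longrightarrow> C2 g \<Longrightarrow> C2 (\<lambda>y. f y + g y)"
  by (simp add: C2_def C1_add partial_add)

lemma C2_diff: "C2 f \<Longrightarrow> C2 g \<Longrightarrow> C2 (\<lambda>y. f y - g y)"
  by (simp add: C2_def C1_diff partial_diff)

lemma C2_mult: "C2 f \<Longrightarrow> C2 g \<Longrightarrow> C2 (\<lambda>y. f y * g y)"
  by (simp add: C2_def C1_mult C1_add partial_mult)

lemma C2_inverse: "C2 f \<Longrightarrow> (\<And>y. f y \<noteq> 0) \<Longrightarrow> C2 (\<lambda>y. inverse (f y))"
  \<comment> \<open>By \<open>partial_inverse\<close>, the derivative of the inverse is a product of
    \<open>C1\<close> functions; the constant -1 accounts for its sign.\<close>
  using C1_mult[OF C1_mult[OF C1_const[of "-1"]] C1_mult[OF C1_inverse C1_inverse], of _ f f]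
  by (simp add: C2_def C1_inverse partial_inverse)

section \<open>Sines and cosines of one coordinate\<close>

lemma has_derivative_sin_component:
  fixes y :: "real ^ 'n"
  shows "((\<lambda>y. sin (c * y $ k)) has_derivative (\<lambda>h. c * cos (c * y $ k) * h $ k)) (at y)"
  by (rule derivative_eq_intros bounded_linear.has_derivative[OF bounded_linear_vec_nth] refl)+
    (auto simp: fun_eq_iff)

lemma has_derivative_cos_component:
  fixes y :: "real ^ 'n"
  shows "((\<lambda>y. cos (c * y $ k)) has_derivative (\<lambda>h. - c * sin (c * y $ k) * h $ k)) (at y)"
  by (rule derivative_eq_intros bounded_linear.has_derivative[OF bounded_linear_vec_nth] refl)+
    (auto simp: fun_eq_iff)

lemma partial_sin:
  "partial i (\<lambda>y. sin (c * y $ k)) = (\<lambda>y. (if i = k then c else 0) * cos (c * y $ k))"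
  using has_derivative_partial[OF has_derivative_sin_component, of i c k]
  by (auto simp: fun_eq_iff axis_def)

lemma partial_cos:
  "partial i (\<lambda>y. cos (c * y $ k)) = (\<lambda>y. (if i = k then - c else 0) * sin (c * y $ k))"
  using has_derivative_partial[OF has_derivative_cos_component, of i c k]
  by (auto simp: fun_eq_iff axis_def)

lemma C1_sin: "C1 (\<lambda>y. sin (c * y $ k))"
  by (rule C1I[OF has_derivative_sin_component]) (intro continuous_intros)

lemma C1_cos: "C1 (\<lambda>y. cos (c * y $ k))"
  by (rule C1I[OF has_derivative_cos_component]) (intro continuous_intros)

lemma C2_sin: "C2 (\<lambda>y. sin (c * y $ k))"
  by (simp only: C2_def partial_sin C1_sin C1_cos C1_mult C1_const simp_thms)

lemma C2_cos: "C2 (\<lambda>y. cos (c * y $ k))"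
  by (simp only: C2_def partial_cos C1_sin C1_cos C1_mult C1_const simp_thms)

section \<open>Periodicity under the integer lattice\<close>

lemma Y_periodic_partial:
  fixes f :: "real ^ 'n \<Rightarrow> real"
  assumes "C1 f" "Y_periodic f"
  shows "Y_periodic (partial i f)"
  unfolding Y_periodic_def
proof (intro allI)
  fix y :: "real ^ 'n" and k
  let ?D = "frechet_derivative f (at (y + axis k 1))"
  \<comment> \<open>A unit translation leaves \<open>f\<close> unchanged and has the identity as
    derivative, so the derivative of \<open>f\<close> at the shifted point is also a derivative at
    \<open>y\<close>.\<close>
  have "(f \<circ> (\<lambda>x. x + axis k 1) has_derivative ?D \<circ> (\<lambda>h. h)) (at y)"
    by (rule diff_chain_at) (auto intro!: derivative_eq_intros C1_has_derivative assms)
  moreover have "f \<circ> (\<lambda>x. x + axis k 1) = f"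
    using assms(2) by (auto simp: Y_periodic_def)
  ultimately show "partial i f (y + axis k 1) = partial i f y"
    using has_derivative_partial by (fastforce simp: partial_def)
qed

lemma Y_periodic_rules:
  "Y_periodic (\<lambda>y. c)"
  "Y_periodic f \<Longrightarrow> Y_periodic g \<Longrightarrow> Y_periodic (\<lambda>y. f y + g y)"
  "Y_periodic f \<Longrightarrow> Y_periodic g \<Longrightarrow> Y_periodic (\<lambda>y. f y - g y)"
  "Y_periodic f \<Longrightarrow> Y_periodic g \<Longrightarrow> Y_periodic (\<lambda>y. f y * g y)"
  by (simp_all add: Y_periodic_def)

lemma Y_periodic_shift_int:
  assumes "Y_periodic f"
  shows "f (y + of_int k *\<^sub>R axis i 1) = f y"
proof (induction k arbitrary: y rule: int_induct[where k = 0])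
  case (step1 m)
  have "f (y + of_int (m + 1) *\<^sub>R axis i 1) = f ((y + of_int m *\<^sub>R axis i 1) + axis i 1)"
    by (simp add: algebra_simps)
  also have "\<dots> = f (y + of_int m *\<^sub>R axis i 1)"
    using assms by (simp only: Y_periodic_def)
  finally show ?case by (simp only: step1)
next
  case (step2 m)
  have "f (y + of_int (m - 1) *\<^sub>R axis i 1) = f ((y + of_int (m - 1) *\<^sub>R axis i 1) + axis i 1)"
    using assms by (simp only: Y_periodic_def)
  also have "\<dots> = f (y + of_int m *\<^sub>R axis i 1)"
    by (simp add: algebra_simps)
  finally show ?case by (simp only: step2)
qed simp

lemma Y_periodic_shift_sum:
  assumes "Y_periodic f" "finite F"
  shows "f (y + (\<Sum>i\<in>F. of_int (k i) *\<^sub>R axis i 1)) = f y"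
  using assms(2)
proof (induction F)
  case (insert i F)
  have "f (y + (\<Sum>i\<in>insert i F. of_int (k i) *\<^sub>R axis i 1))
      = f (y + (\<Sum>i\<in>F. of_int (k i) *\<^sub>R axis i 1) + of_int (k i) *\<^sub>R axis i 1)"
    using insert.hyps by (simp add: algebra_simps)
  then show ?case
    by (simp only: Y_periodic_shift_int[OF assms(1)] insert.IH)
qed simp

text \<open>Taking fractional parts componentwise changes a point by an integer vector. This extends
  identities from \<open>Y\<close>, where the differential equations are imposed, to the whole
  space.\<close>

lemma Y_periodic_representative:
  fixes f :: "real ^ 'n \<Rightarrow> 'b"
  assumes "Y_periodic f"
  obtains z where "z \<in> Y" "f y = f z"
proof
  let ?z = "(\<chi> i. frac (y $ i)) :: real ^ 'n"
  show "?z \<in> Y"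
    by (auto simp: Y_def mem_box_cart less_imp_le[OF frac_lt_1])
  have "y = ?z + (\<Sum>i\<in>UNIV. of_int \<lfloor>y $ i\<rfloor> *\<^sub>R axis i 1)"
    by (simp add: vec_eq_iff frac_def axis_def if_distrib sum.delta cong: if_cong)
  then have "f y = f (?z + (\<Sum>i\<in>UNIV. of_int \<lfloor>y $ i\<rfloor> *\<^sub>R axis i 1))"
    by (rule arg_cong)
  also have "\<dots> = f ?z"
    by (rule Y_periodic_shift_sum[OF assms finite])
  finally show "f y = f ?z" .
qed

section \<open>Integration over the period cell\<close>

lemma mem_cbox_2:
  fixes y :: "real ^ 2"
  shows "y \<in> cbox u v \<longleftrightarrow> u $ 1 \<le> y $ 1 \<and> y $ 1 \<le> v $ 1 \<and> u $ 2 \<le> y $ 2 \<and> y $ 2 \<le> v $ 2"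
  by (auto simp: mem_box_cart forall_2)

lemma continuous_on_vector_2:
  fixes f g :: "'a :: topological_space \<Rightarrow> real"
  assumes "continuous_on S f" "continuous_on S g"
  shows "continuous_on S (\<lambda>x. vector [f x, g x] :: real ^ 2)"
proof -
  have *: "(\<lambda>x. vector [f x, g x] :: real ^ 2) = (\<lambda>x. \<chi> i. if i = 1 then f x else g x)"
    by (auto simp: vec_eq_iff forall_2 fun_eq_iff)
  have "continuous_on S (\<lambda>x. if i = 1 then f x else g x)" for i :: 2
    using assms by (cases "i = 1") auto
  then show ?thesis
    unfolding * by (rule continuous_on_vec_lambda)
qed

text \<open>The coordinate map between \<open>real ^ 2\<close> and pairs is a bijection that sends
  boxes to boxes of the same volume, so the change of variables has factor 1. On pairs, iterated
  integration applies.\<close>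

lemma integral_Y_prod:
  fixes f :: "real ^ 2 \<Rightarrow> real"
  assumes "continuous_on UNIV f"
  shows "integral Y f = integral (cbox (0, 0) (1, 1)) (\<lambda>(x, y). f (vector [x, y]))"
proof -
  let ?g = "\<lambda>p. vector [fst p, snd p] :: real ^ 2" and ?h = "\<lambda>y :: real ^ 2. (y $ 1, y $ 2)"
  have gh: "?g (?h y) = y" for y
    by (simp add: vec_eq_iff forall_2)
  have g: "?g ` cbox u v = cbox (?g u) (?g v)" for u v :: "real \<times> real"
  proof -
    have "y \<in> ?g ` cbox u v \<longleftrightarrow> ?h y \<in> cbox u v" for y
      using gh by (auto simp: image_iff intro!: bexI[of _ "?h y"])
    then show ?thesis
      by (cases u; cases v) (auto simp: mem_cbox_2)
  qed
  have h: "?h ` cbox u v = cbox (?h u) (?h v)" for u v :: "real ^ 2"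
  proof -
    have "cbox u v = ?g ` cbox (?h u) (?h v)"
      unfolding g gh ..
    then show ?thesis by (simp add: image_image)
  qed
  have c: "measure lborel (?g ` cbox u v) = 1 * measure lborel (cbox u v)" for u v :: "real \<times> real"
  proof (cases u; cases v)
    fix u1 u2 v1 v2 assume uv: "u = (u1, u2)" "v = (v1, v2)"
    \<comment> \<open>Content is the product of the side lengths only for nonempty boxes, so
      emptiness is characterized first.\<close>
    have "cbox (?g u) (?g v) = {} \<longleftrightarrow> \<not> (u1 \<le> v1 \<and> u2 \<le> v2)"
      using interval_ne_empty_cart(1)[of "?g u" "?g v"] by (auto simp: uv forall_2)
    then show ?thesis
      unfolding g content_cbox_if_cart by (simp add: uv content_Pair UNIV_2)
  qed
  have "f integrable_on cbox 0 1"
    by (rule integrable_continuous) (rule continuous_on_subset[OF assms subset_UNIV])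
  then have "(f has_integral integral Y f) (cbox 0 1)"
    by (simp add: Y_def integrable_integral)
  moreover have "isCont ?g p" for p
    using continuous_on_vector_2[of UNIV fst snd] by (cases p)
      (simp add: continuous_on_eq_continuous_at continuous_on_fst continuous_on_snd)
  ultimately have "((\<lambda>x. f (?g x)) has_integral (1 / 1) *\<^sub>R integral Y f) (?h ` cbox 0 1)"
    by (intro has_integral_twiddle[of 1 ?h ?g, OF zero_less_one _ gh _ _ _ c]) (auto simp: g h)
  then show ?thesis
    by (simp add: h case_prod_unfold integral_unique)
qed

lemma integral_Y_iterated:
  fixes f :: "real ^ 2 \<Rightarrow> real"
  assumes "continuous_on UNIV f"
  shows "integral Y f = integral {0..1} (\<lambda>x. integral {0..1} (\<lambda>y. f (vector [x, y])))"
    and "integral Y f = integral {0..1} (\<lambda>y. integral {0..1} (\<lambda>x. f (vector [x, y])))"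
proof -
  have c: "continuous_on (cbox (0, 0) (1, 1)) (\<lambda>(x, y). f (vector [x, y]))"
    unfolding case_prod_beta
    by (intro continuous_on_compose2[OF assms] continuous_on_vector_2 continuous_intros) auto
  show "integral Y f = integral {0..1} (\<lambda>x. integral {0..1} (\<lambda>y. f (vector [x, y])))"
    using integral_prod_continuous[OF c] by (simp add: integral_Y_prod[OF assms])
  then show "integral Y f = integral {0..1} (\<lambda>y. integral {0..1} (\<lambda>x. f (vector [x, y])))"
    using integral_swap_continuous[OF c] by simp
qed

lemma integral_Y_separated:
  fixes f g :: "real \<Rightarrow> real"
  assumes "continuous_on UNIV f" "continuous_on UNIV g"
  shows "integral Y (\<lambda>y :: real ^ 2. f (y $ 1) * g (y $ 2)) = integral {0..1} f * integral {0..1} g"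
proof -
  have "continuous_on UNIV (\<lambda>y :: real ^ 2. f (y $ 1) * g (y $ 2))"
    by (intro continuous_on_mult continuous_on_compose2[OF assms(1)] continuous_on_compose2[OF assms(2)]
        continuous_intros) auto
  then show ?thesis
    by (simp add: integral_Y_iterated(1))
qed

text \<open>By the fundamental theorem of calculus the integral is the difference of
  \<open>G\<close> at two points one unit translation apart.\<close>

lemma integral_derivative_along_axis:
  fixes G :: "real ^ 'n \<Rightarrow> real"
  assumes "C1 G" "Y_periodic G"
  shows "integral {0..1} (\<lambda>t. partial i G (p + t *\<^sub>R axis i 1)) = 0"
proof -
  have "((\<lambda>t. G (p + t *\<^sub>R axis i 1)) has_vector_derivative partial i G (p + t *\<^sub>R axis i 1)) (at t)" for t
  proof -
    let ?D = "frechet_derivative G (at (p + t *\<^sub>R axis i 1))"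
    have "(G \<circ> (\<lambda>t. p + t *\<^sub>R axis i 1) has_derivative ?D \<circ> (\<lambda>h. h *\<^sub>R axis i 1)) (at t)"
      by (rule diff_chain_at) (auto intro!: derivative_eq_intros C1_has_derivative assms)
    moreover have "linear ?D"
      using C1_has_derivative[OF assms(1)] has_derivative_linear by blast
    ultimately show ?thesis
      by (simp add: has_vector_derivative_def partial_def o_def linear_scale)
  qed
  then have "((\<lambda>t. partial i G (p + t *\<^sub>R axis i 1)) has_integral
      G (p + 1 *\<^sub>R axis i 1) - G (p + 0 *\<^sub>R axis i 1)) {0..1}"
    by (intro fundamental_theorem_of_calculus) (auto intro: has_vector_derivative_at_within)
  then show ?thesis
    using assms(2) by (simp add: Y_periodic_def integral_unique)
qed

text \<open>Integrating first in the direction of differentiation makes the inner integral vanish;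
  this is why both orders of iterated integration are provided. It serves as the divergence theorem
  on the torus.\<close>

lemma integral_Y_partial:
  fixes G :: "real ^ 2 \<Rightarrow> real"
  assumes "C1 G" "Y_periodic G"
  shows "integral Y (partial i G) = 0"
proof -
  have 1: "vector [x, y] = vector [0, y] + x *\<^sub>R (axis 1 1 :: real ^ 2)"
    and 2: "vector [x, y] = vector [x, 0] + y *\<^sub>R (axis 2 1 :: real ^ 2)" for x y :: real
    by (auto simp: vec_eq_iff forall_2 axis_def)
  have I1: "integral {0..1} (\<lambda>x. partial 1 G (vector [x, y])) = 0" for y
    by (subst 1) (rule integral_derivative_along_axis[OF assms])
  have I2: "integral {0..1} (\<lambda>y. partial 2 G (vector [x, y])) = 0" for x
    by (subst 2) (rule integral_derivative_along_axis[OF assms])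
  consider "i = 1" | "i = 2"
    using exhaust_2 by blast
  then show ?thesis
    by cases (simp_all only: integral_Y_iterated(2)[OF C1_partial_continuous[OF assms(1), of _ 1]]
        integral_Y_iterated(1)[OF C1_partial_continuous[OF assms(1), of _ 2]] I1 I2 integral_0)
qed

text \<open>Common end of both energy arguments. The divergence of a periodic field has integral
  zero; being continuous and nonnegative here, it vanishes on \<open>Y\<close>. Positive weights
  then force the gradient of \<open>u\<close> to vanish on the convex set \<open>Y\<close>, and
  periodicity carries the constant value to the plane.\<close>

lemma constant_if_weighted_gradient_is_divergence:
  fixes u a b F G :: "real ^ 2 \<Rightarrow> real"
  assumes u: "C1 u" "Y_periodic u"
    and F: "C1 F" "Y_periodic F" and G: "C1 G" "Y_periodic G"
    and pos: "\<And>y. y \<in> Y \<Longrightarrow> 0 < a y" "\<And>y. y \<in> Y \<Longrightarrow> 0 < b y"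
    and eq: "\<And>y. y \<in> Y \<Longrightarrow> partial 1 F y + partial 2 G y = a y * (partial 1 u y)\<^sup>2 + b y * (partial 2 u y)\<^sup>2"
  obtains c where "u = (\<lambda>_. c)"
proof -
  let ?e = "\<lambda>y. partial 1 F y + partial 2 G y"
  have int: "partial i H integrable_on Y" if "C1 H" for i and H :: "real ^ 2 \<Rightarrow> real"
    unfolding Y_def by (rule integrable_continuous) (rule C1_partial_continuous[OF that])
  have "integral Y ?e = 0"
    by (simp add: integral_add int F G integral_Y_partial)
  moreover have "continuous_on (cbox 0 1) ?e"
    by (intro continuous_intros C1_partial_continuous F G)
  \<comment> \<open>Nonempty interior lets a zero integral of a continuous nonnegative function
    force it to vanish on the whole closed cell.\<close>
  moreover have "box 0 1 \<noteq> ({} :: (real ^ 2) set)"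
    by (simp add: interval_eq_empty_cart)
  moreover have "0 \<le> ?e y" if "y \<in> Y" for y
    using pos[OF that] by (simp add: eq[OF that])
  ultimately have e0: "?e y = 0" if "y \<in> Y" for y
    using that by (simp add: Y_def integral_cbox_eq_0_iff)
  have "partial i u y = 0" if "y \<in> Y" for y i
  proof -
    have "a y * (partial 1 u y)\<^sup>2 + b y * (partial 2 u y)\<^sup>2 = 0"
      using e0 eq that by metis
    then have "partial 1 u y = 0 \<and> partial 2 u y = 0"
      using pos[OF that] by (simp add: add_nonneg_eq_0_iff)
    then show ?thesis using exhaust_2[of i] by auto
  qed
  then have D0: "frechet_derivative u (at y) = (\<lambda>h. 0)" if "y \<in> Y" for y
  proof -
    have lin: "linear (frechet_derivative u (at y))"
      using C1_has_derivative[OF u(1)] has_derivative_linear by blast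
    show ?thesis
      using \<open>\<And>y i. y \<in> Y \<Longrightarrow> partial i u y = 0\<close> that
      by (intro linear_eq_stdbasis[OF lin]) (auto simp: Basis_vec_def partial_def linear_zero)
  qed
  have "(u has_derivative (\<lambda>h. 0)) (at y within Y)" if "y \<in> Y" for y
    using C1_has_derivative[OF u(1), of y] by (simp add: D0[OF that] has_derivative_at_withinI)
  then obtain c where c: "\<And>y. y \<in> Y \<Longrightarrow> u y = c"
    using has_derivative_zero_constant[of Y u] by (auto simp: Y_def)
  have "u y = c" for y
    using Y_periodic_representative[OF u(2), of y] c by metis
  then show ?thesis using that by blast
qed

section \<open>Uniqueness for diagonal coefficients\<close>

lemmas C1_rules = C1_const C1_add C1_diff C1_mult C1_sin C1_cos C2_imp_C1 C2_partial_C1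
lemmas partial_rules = partial_const partial_add partial_diff partial_mult

text \<open>Multiply the equation by \<open>u\<close> and integrate by parts twice: the term with
  \<open>u^2\<close> carries the double divergence of the weights, which is zero. This will be
  applied to the difference of two correctors.\<close>

lemma periodic_null_nondivergence_constant:
  fixes a b u :: "real ^ 2 \<Rightarrow> real"
  assumes a: "C2 a" "Y_periodic a" "\<And>y. 0 < a y" and b: "C2 b" "Y_periodic b" "\<And>y. 0 < b y"
    and ab: "\<And>y. y \<in> Y \<Longrightarrow> partial 1 (partial 1 a) y + partial 2 (partial 2 b) y = 0"
    and u: "C2 u" "Y_periodic u"
    and eq: "\<And>y. y \<in> Y \<Longrightarrow> a y * partial 1 (partial 1 u) y + b y * partial 2 (partial 2 u) y = 0"
  obtains c where "u = (\<lambda>_. c)"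
proof -
  note result = that
  \<comment> \<open>The second term is chosen so that the mixed products of \<open>u\<close>, the
    derivative of \<open>u\<close> and the derivative of \<open>a\<close> cancel on
    differentiation.\<close>
  let ?F = "\<lambda>i a y. a y * (u y * partial i u y) - 1/2 * (partial i a y * (u y * u y))"
  show ?thesis
  proof (rule constant_if_weighted_gradient_is_divergence[of u "?F 1 a" "?F 2 b" a b])
    show "C1 (?F 1 a)" "C1 (?F 2 b)"
      by (intro C1_rules a b u)+
    show "Y_periodic (?F 1 a)" "Y_periodic (?F 2 b)"
      by (intro Y_periodic_rules Y_periodic_partial C1_rules a b u)+
    show "partial 1 (?F 1 a) y + partial 2 (?F 2 b) y = a y * (partial 1 u y)\<^sup>2 + b y * (partial 2 u y)\<^sup>2"
      if "y \<in> Y" for y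
    proof -
      have *: "partial i (?F i h) y = h y * (partial i u y)\<^sup>2
          + u y * (h y * partial i (partial i u) y) - 1/2 * (u y)\<^sup>2 * partial i (partial i h) y" if "C2 h" for i h
        using that u(1) by (simp only: partial_rules C1_rules) (simp add: algebra_simps power2_eq_square)
      have "partial 1 (?F 1 a) y + partial 2 (?F 2 b) y = a y * (partial 1 u y)\<^sup>2 + b y * (partial 2 u y)\<^sup>2
          + u y * (a y * partial 1 (partial 1 u) y + b y * partial 2 (partial 2 u) y)
          - 1/2 * (u y)\<^sup>2 * (partial 1 (partial 1 a) y + partial 2 (partial 2 b) y)"
        unfolding *[OF a(1)] *[OF b(1)] by (simp only: ring_distribs)
      then show ?thesis using eq[OF that] ab[OF that] by simp
    qed
    show "C1 u" "Y_periodic u" "0 < a y" "0 < b y" for y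
      by (simp_all add: C2_imp_C1 a b u)
    show thesis if "u = (\<lambda>_. c)" for c
      using result that by blast
  qed
qed

text \<open>The adjoint counterpart of the previous energy identity, again obtained by multiplying
  by the solution. It will be applied to the quotient of two invariant measures.\<close>

lemma periodic_null_double_divergence_constant:
  fixes a b q :: "real ^ 2 \<Rightarrow> real"
  assumes a: "C2 a" "Y_periodic a" "\<And>y. 0 < a y" and b: "C2 b" "Y_periodic b" "\<And>y. 0 < b y"
    and ab: "\<And>y. y \<in> Y \<Longrightarrow> partial 1 (partial 1 a) y + partial 2 (partial 2 b) y = 0"
    and q: "C2 q" "Y_periodic q"
    and eq: "\<And>y. y \<in> Y \<Longrightarrow>
      partial 1 (partial 1 (\<lambda>z. a z * q z)) y + partial 2 (partial 2 (\<lambda>z. b z * q z)) y = 0"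
  obtains c where "q = (\<lambda>_. c)"
proof -
  note result = that
  \<comment> \<open>By the product rule, half of the derivative of \<open>q^2\<close> times that of
    \<open>a\<close> removes the mixed term and leaves the square weighted by
    \<open>a\<close>.\<close>
  let ?F = "\<lambda>i a y. q y * partial i (\<lambda>z. a z * q z) y - 1/2 * (partial i a y * (q y * q y))"
  show ?thesis
  proof (rule constant_if_weighted_gradient_is_divergence[of q "?F 1 a" "?F 2 b" a b])
    show "C1 (?F 1 a)" "C1 (?F 2 b)"
      by (intro C1_rules C2_mult a b q)+
    show "Y_periodic (?F 1 a)" "Y_periodic (?F 2 b)"
      by (intro Y_periodic_rules Y_periodic_partial C1_rules a b q)+
    show "partial 1 (?F 1 a) y + partial 2 (?F 2 b) y = a y * (partial 1 q y)\<^sup>2 + b y * (partial 2 q y)\<^sup>2"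
      if "y \<in> Y" for y
    proof -
      have *: "partial i (?F i h) y = h y * (partial i q y)\<^sup>2
          + q y * partial i (partial i (\<lambda>z. h z * q z)) y - 1/2 * (q y)\<^sup>2 * partial i (partial i h) y" if "C2 h" for i h
        using that q(1) by (simp only: partial_rules C1_rules) (simp add: algebra_simps power2_eq_square)
      have "partial 1 (?F 1 a) y + partial 2 (?F 2 b) y = a y * (partial 1 q y)\<^sup>2 + b y * (partial 2 q y)\<^sup>2
          + q y * (partial 1 (partial 1 (\<lambda>z. a z * q z)) y + partial 2 (partial 2 (\<lambda>z. b z * q z)) y)
          - 1/2 * (q y)\<^sup>2 * (partial 1 (partial 1 a) y + partial 2 (partial 2 b) y)"
        unfolding *[OF a(1)] *[OF b(1)] by (simp only: ring_distribs)
      then show ?thesis using eq[OF that] ab[OF that] by simp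
    qed
    show "C1 q" "Y_periodic q" "0 < a y" "0 < b y" for y
      by (simp_all add: C2_imp_C1 a b q)
    show thesis if "q = (\<lambda>_. c)" for c
      using result that by blast
  qed
qed

section \<open>From the energy identities to the invariant measure and the correctors\<close>

lemma sym_pos_def_diagonal_pos:
  fixes M :: "real ^ 'n ^ 'n"
  assumes "sym_pos_def M"
  shows "0 < M $ i $ i"
proof -
  have "0 < axis i 1 \<bullet> (M *v axis i 1)"
    using assms by (simp add: sym_pos_def_def axis_eq_0_iff)
  then show ?thesis
    by (simp add: inner_axis' matrix_vector_mult_basis column_def)
qed

text \<open>The diagonal entries of \<open>A\<close> times \<open>r\<close> satisfy what the two
  energy lemmas require of \<open>a\<close> and \<open>b\<close>; the vanishing double divergence is
  the equation of the invariant measure itself.\<close>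

lemma diagonal_invariant_weights:
  fixes A :: "real ^ 2 \<Rightarrow> real ^ 2 ^ 2"
  assumes A: "A \<in> C2_torus_spd" and diag: "\<And>y. A y $ 1 $ 2 = 0" "\<And>y. A y $ 2 $ 1 = 0"
    and r: "is_invariant_measure A r"
  shows "C2 (\<lambda>z. A z $ i $ i * r z)" "Y_periodic (\<lambda>z. A z $ i $ i * r z)" "0 < A y $ i $ i * r y"
    and "y \<in> Y \<Longrightarrow> partial 1 (partial 1 (\<lambda>z. A z $ 1 $ 1 * r z)) y + partial 2 (partial 2 (\<lambda>z. A z $ 2 $ 2 * r z)) y = 0"
proof -
  show "C2 (\<lambda>z. A z $ i $ i * r z)" "Y_periodic (\<lambda>z. A z $ i $ i * r z)" "0 < A y $ i $ i * r y"
    using A r by (auto simp: C2_torus_spd_def is_invariant_measure_def Y_periodic_def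
        intro!: C2_mult mult_pos_pos sym_pos_def_diagonal_pos)
  show "partial 1 (partial 1 (\<lambda>z. A z $ 1 $ 1 * r z)) y + partial 2 (partial 2 (\<lambda>z. A z $ 2 $ 2 * r z)) y = 0"
    if "y \<in> Y"
    using r that by (auto simp: is_invariant_measure_def sum_2 diag partial_const)
qed

text \<open>For a second invariant measure \<open>s\<close>, the quotient \<open>s / r\<close>
  solves the double divergence equation with the weights coming from \<open>r\<close>, because
  weight times quotient gives back the entry of \<open>A\<close> times \<open>s\<close>. Hence
  \<open>s\<close> is a multiple of \<open>r\<close>, and the normalization makes the factor
  1.\<close>

lemma invariant_measure_eq:
  fixes A :: "real ^ 2 \<Rightarrow> real ^ 2 ^ 2"
  assumes A: "A \<in> C2_torus_spd" and diag: "\<And>y. A y $ 1 $ 2 = 0" "\<And>y. A y $ 2 $ 1 = 0"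
    and r: "is_invariant_measure A r"
  shows "invariant_measure A = r"
  unfolding invariant_measure_def
proof (rule the_equality)
  fix s assume s: "is_invariant_measure A s"
  have r0: "r y \<noteq> 0" for y
    using r by (metis is_invariant_measure_def less_irrefl)
  note wt = diagonal_invariant_weights[OF A diag r]
  let ?q = "\<lambda>y. s y * inverse (r y)"
  have eq: "(\<lambda>z. A z $ i $ i * r z * ?q z) = (\<lambda>z. A z $ i $ i * s z)" for i
    using r0 by (intro ext) (simp add: right_inverse)
  have q: "C2 ?q" "Y_periodic ?q"
    using r s r0 by (auto simp: is_invariant_measure_def Y_periodic_def intro!: C2_mult C2_inverse)
  obtain c where "?q = (\<lambda>_. c)"
    by (rule periodic_null_double_divergence_constant
        [OF wt(1-3)[where i = 1] wt(1-3)[where i = 2] wt(4) q, unfolded eq, OF _ diagonal_invariant_weights(4)[OF A diag s]])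
  then have c: "s y = c * r y" for y
    using r0[of y] fun_cong[of ?q _ y] by (auto simp: divide_inverse[symmetric] nonzero_divide_eq_eq)
  have "s = (\<lambda>y. c * r y)"
    using c by blast
  then have "integral Y s = c * integral Y r"
    by simp
  then have "c = 1"
    using r s by (simp add: is_invariant_measure_def)
  then show "s = r"
    using c by auto
qed (rule r)

lemma has_integral_Y_const: "((\<lambda>y :: real ^ 'n. c) has_integral (c :: 'b :: real_normed_vector)) Y"
  using has_integral_const[of c "0 :: real ^ 'n" 1]
  by (simp add: Y_def content_cbox_if_cart interval_eq_empty_cart)

text \<open>The difference of two correctors solves the homogeneous equation. Multiplication by
  \<open>r\<close> turns the coefficients into weights with vanishing double divergence, so the
  difference is constant, and the zero means make it 0.\<close>

lemma corrector_eq: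
  fixes A :: "real ^ 2 \<Rightarrow> real ^ 2 ^ 2"
  assumes A: "A \<in> C2_torus_spd" and diag: "\<And>y. A y $ 1 $ 2 = 0" "\<And>y. A y $ 2 $ 1 = 0"
    and r: "is_invariant_measure A r" and v: "is_corrector A k l v"
  shows "corrector A k l = v"
  unfolding corrector_def
proof (rule the_equality)
  fix w assume w: "is_corrector A k l w"
  let ?u = "\<lambda>y. w y - v y"
  have C: "C2 v" "C2 w"
    using v w by (auto simp: is_corrector_def)
  have u: "C2 ?u" "Y_periodic ?u"
    using v w by (auto simp: is_corrector_def Y_periodic_def intro!: C2_diff)
  have eq: "A y $ 1 $ 1 * r y * partial 1 (partial 1 ?u) y + A y $ 2 $ 2 * r y * partial 2 (partial 2 ?u) y = 0"
    if "y \<in> Y" for y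
  proof -
    have "frob (A y) (hessian w y) = frob (A y) (hessian v y)"
      using v w that unfolding is_corrector_def by (metis neg_equal_iff_equal)
    then have "A y $ 1 $ 1 * partial 1 (partial 1 ?u) y + A y $ 2 $ 2 * partial 2 (partial 2 ?u) y = 0"
      using C by (simp add: partial_diff C2_imp_C1 C2_partial_C1 frob_def hessian_def sum_2 diag algebra_simps)
    moreover have "A y $ 1 $ 1 * r y * X + A y $ 2 $ 2 * r y * Z = r y * (A y $ 1 $ 1 * X + A y $ 2 $ 2 * Z)" for X Z
      by (simp add: algebra_simps)
    ultimately show ?thesis by (simp only: mult_zero_right)
  qed
  note wt = diagonal_invariant_weights[OF A diag r]
  obtain c where c: "?u = (\<lambda>_. c)"
    by (rule periodic_null_nondivergence_constant[OF wt(1-3)[where i = 1] wt(1-3)[where i = 2] wt(4) u eq])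
  have "w integrable_on Y" "v integrable_on Y"
    unfolding Y_def by (intro integrable_continuous C1_continuous C2_imp_C1 C)+
  then have "integral Y ?u = 0"
    using v w by (simp add: is_corrector_def integral_diff)
  then have "c = 0"
    unfolding c by (simp add: integral_unique[OF has_integral_Y_const])
  then show "w = v"
    using c by (auto simp: fun_eq_iff)
qed (rule v)

section \<open>The trigonometric example\<close>

text \<open>Up to factors \<open>2 * pi\<close> and signs, \<open>partial 1\<close> and
  \<open>partial 2\<close> permute these four products, so every derivative below stays in their
  span.\<close>

definition ss :: "real ^ 2 \<Rightarrow> real" where "ss y = sin (2 * pi * y $ 1) * sin (2 * pi * y $ 2)"
definition cs :: "real ^ 2 \<Rightarrow> real" where "cs y = cos (2 * pi * y $ 1) * sin (2 * pi * y $ 2)"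
definition sc :: "real ^ 2 \<Rightarrow> real" where "sc y = sin (2 * pi * y $ 1) * cos (2 * pi * y $ 2)"
definition cc :: "real ^ 2 \<Rightarrow> real" where "cc y = cos (2 * pi * y $ 1) * cos (2 * pi * y $ 2)"

lemma C2_trig: "C2 ss" "C2 cs" "C2 sc" "C2 cc"
  unfolding ss_def[abs_def] cs_def[abs_def] sc_def[abs_def] cc_def[abs_def]
  by (intro C2_mult C2_sin C2_cos)+

lemmas C1_trig = C2_trig[THEN C2_imp_C1]

lemma Y_periodic_trig: "Y_periodic ss" "Y_periodic cs"
proof -
  have "sin (2 * pi * (x + (if i = k then 1 else 0))) = sin (2 * pi * x)"
    "cos (2 * pi * (x + (if i = k then 1 else 0))) = cos (2 * pi * x)" for x and i k :: 2
    by (simp_all add: distrib_left sin_add cos_add)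
  then show "Y_periodic ss" "Y_periodic cs"
    by (simp_all add: Y_periodic_def ss_def cs_def axis_def)
qed

lemma partial_trig:
  "partial 1 ss = (\<lambda>y. 2 * pi * cs y)" "partial 2 ss = (\<lambda>y. 2 * pi * sc y)"
  "partial 1 cs = (\<lambda>y. - (2 * pi) * ss y)" "partial 2 cs = (\<lambda>y. 2 * pi * cc y)"
  "partial 2 sc = (\<lambda>y. - (2 * pi) * ss y)" "partial 2 cc = (\<lambda>y. - (2 * pi) * cs y)"
  unfolding ss_def[abs_def] cs_def[abs_def] sc_def[abs_def] cc_def[abs_def]
  by (simp_all only: partial_mult C1_sin C1_cos partial_sin partial_cos) (simp_all add: fun_eq_iff)

lemma integral_trig_1:
  "integral {0..1} (\<lambda>t. sin (2 * pi * t)) = 0"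
  "integral {0..1} (\<lambda>t. cos (2 * pi * t)) = 0"
  "integral {0..1} (\<lambda>t. sin (2 * pi * t) * sin (2 * pi * t)) = 1/2"
  "integral {0..1} (\<lambda>t. sin (2 * pi * t) * cos (2 * pi * t)) = 0"
proof -
  have FTC: "integral {0..1} f = F 1 - F 0"
    if "\<And>t. (F has_real_derivative f t) (at t)" for f F :: "real \<Rightarrow> real"
    by (intro integral_unique fundamental_theorem_of_calculus)
      (auto intro!: has_field_derivative_at_within that simp flip: has_real_derivative_iff_has_vector_derivative)
  show "integral {0..1} (\<lambda>t. sin (2 * pi * t)) = 0"
    by (subst FTC[where F = "\<lambda>t. - cos (2 * pi * t) / (2 * pi)"]) (auto intro!: derivative_eq_intros)
  show "integral {0..1} (\<lambda>t. cos (2 * pi * t)) = 0"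
    by (subst FTC[where F = "\<lambda>t. sin (2 * pi * t) / (2 * pi)"]) (auto intro!: derivative_eq_intros)
  \<comment> \<open>This primitive comes from the half-angle formula for the squared sine, with the
    sine of the double angle expanded.\<close>
  have "((\<lambda>t. t / 2 - sin (2 * pi * t) * cos (2 * pi * t) / (4 * pi)) has_real_derivative
      sin (2 * pi * t) * sin (2 * pi * t)) (at t)" for t
  proof -
    have "((\<lambda>t. t / 2 - sin (2 * pi * t) * cos (2 * pi * t) / (4 * pi)) has_real_derivative
        1/2 - ((cos (2 * pi * t))\<^sup>2 - (sin (2 * pi * t))\<^sup>2) / 2) (at t)"
      by (auto intro!: derivative_eq_intros simp: field_simps power2_eq_square)
    moreover have "1/2 - ((cos x)\<^sup>2 - (sin x)\<^sup>2) / 2 = sin x * sin x" for x :: real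
      by (simp add: cos_squared_eq field_simps power2_eq_square)
    ultimately show ?thesis by simp
  qed
  from FTC[OF this] show "integral {0..1} (\<lambda>t. sin (2 * pi * t) * sin (2 * pi * t)) = 1/2"
    by simp
  show "integral {0..1} (\<lambda>t. sin (2 * pi * t) * cos (2 * pi * t)) = 0"
    by (subst FTC[where F = "\<lambda>t. sin (2 * pi * t) * sin (2 * pi * t) / (4 * pi)"])
      (auto intro!: derivative_eq_intros simp: field_simps)
qed

text \<open>Each integrand separates into one-dimensional factors. Among the products, only the
  square of \<open>ss\<close> survives orthogonality, with value 1/2 times 1/2.\<close>

lemma has_integral_trig:
  "(ss has_integral 0) Y" "(cs has_integral 0) Y" "(sc has_integral 0) Y" "(cc has_integral 0) Y"
  "((\<lambda>y. ss y * ss y) has_integral 1/4) Y" "((\<lambda>y. ss y * cs y) has_integral 0) Y"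
  "((\<lambda>y. ss y * sc y) has_integral 0) Y" "((\<lambda>y. ss y * cc y) has_integral 0) Y"
proof -
  let ?s = "\<lambda>t :: real. sin (2 * pi * t)" and ?c = "\<lambda>t :: real. cos (2 * pi * t)"
  have I: "(h has_integral i) Y"
    if "h = (\<lambda>y. f (y $ 1) * g (y $ 2))" "continuous_on UNIV f" "continuous_on UNIV g"
      "integral {0..1} f * integral {0..1} g = i" for f g :: "real \<Rightarrow> real" and h :: "real ^ 2 \<Rightarrow> real" and i
  proof -
    have "h integrable_on Y"
      unfolding that(1) Y_def
      by (intro integrable_continuous continuous_intros continuous_on_compose2[OF that(2)]
          continuous_on_compose2[OF that(3)]) auto
    then show ?thesis
      using integral_Y_separated[OF that(2,3)] that(1,4) by (simp add: has_integral_integrable_integral)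
  qed
  show "(ss has_integral 0) Y"
    by (rule I[of _ ?s ?s]) (auto simp: ss_def fun_eq_iff integral_trig_1 intro!: continuous_intros)
  show "(cs has_integral 0) Y"
    by (rule I[of _ ?c ?s]) (auto simp: cs_def fun_eq_iff integral_trig_1 intro!: continuous_intros)
  show "(sc has_integral 0) Y"
    by (rule I[of _ ?s ?c]) (auto simp: sc_def fun_eq_iff integral_trig_1 intro!: continuous_intros)
  show "(cc has_integral 0) Y"
    by (rule I[of _ ?c ?c]) (auto simp: cc_def fun_eq_iff integral_trig_1 intro!: continuous_intros)
  show "((\<lambda>y. ss y * ss y) has_integral 1/4) Y"
    by (rule I[of _ "\<lambda>t. ?s t * ?s t" "\<lambda>t. ?s t * ?s t"])
      (simp_all add: ss_def fun_eq_iff integral_trig_1 continuous_intros)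
  show "((\<lambda>y. ss y * cs y) has_integral 0) Y"
    by (rule I[of _ "\<lambda>t. ?s t * ?c t" "\<lambda>t. ?s t * ?s t"])
      (simp_all add: ss_def cs_def fun_eq_iff integral_trig_1 continuous_intros)
  show "((\<lambda>y. ss y * sc y) has_integral 0) Y"
    by (rule I[of _ "\<lambda>t. ?s t * ?s t" "\<lambda>t. ?s t * ?c t"])
      (simp_all add: ss_def sc_def fun_eq_iff integral_trig_1 continuous_intros)
  show "((\<lambda>y. ss y * cc y) has_integral 0) Y"
    by (rule I[of _ "\<lambda>t. ?s t * ?c t" "\<lambda>t. ?s t * ?c t"])
      (simp_all add: ss_def cc_def fun_eq_iff integral_trig_1 continuous_intros)
qed

lemma C2_trig_combination: "C2 (\<lambda>y. a * cs y + b * ss y)"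
  by (intro C2_add C2_mult C2_const C2_trig)

lemma partial_trig_combination:
  "partial 1 (\<lambda>y. a * cs y + b * ss y) = (\<lambda>y. - (2 * pi * a) * ss y + 2 * pi * b * cs y)"
  "partial 2 (\<lambda>y. a * cs y + b * ss y) = (\<lambda>y. 2 * pi * a * cc y + 2 * pi * b * sc y)"
  by (simp_all only: partial_rules C1_mult C1_const C1_trig partial_trig) (simp_all add: algebra_simps)

lemma partial_partial_trig_combination:
  "partial 1 (partial 1 (\<lambda>y. a * cs y + b * ss y)) y = - (4 * pi\<^sup>2) * (a * cs y + b * ss y)"
  "partial 2 (partial 2 (\<lambda>y. a * cs y + b * ss y)) y = - (4 * pi\<^sup>2) * (a * cs y + b * ss y)"
  unfolding partial_trig_combination
  by (simp_all only: partial_rules C1_mult C1_const C1_trig partial_trig)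
    (simp_all add: algebra_simps power2_eq_square)

lemma abs_trig_le_1: "\<bar>ss y\<bar> \<le> 1" "\<bar>cs y\<bar> \<le> 1"
  by (simp_all add: ss_def cs_def abs_mult mult_le_one)

theorem theorem1p4:
  fixes r :: "real ^ 2 \<Rightarrow> real" and A :: "real ^ 2 \<Rightarrow> real ^ 2 ^ 2"
  assumes r_eq: "\<And>y. r y = 1 + 1 / 4 * (cos (2 * pi * y $ 1) - 2 * sin (2 * pi * y $ 1)) * sin (2 * pi * y $ 2)"
    and A_eq: "\<And>y. A y = (1 / r y) *\<^sub>R
      vector [vector [1 - 1 / 2 * sin (2 * pi * y $ 1) * sin (2 * pi * y $ 2), 0],
              vector [0, 1 + 1 / 2 * sin (2 * pi * y $ 1) * sin (2 * pi * y $ 2)]]"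
  shows "c_bad A \<and>
    c_const A 1 1 1 = - (1 / (128 * pi)) \<and>
    c_const A 1 2 2 = - (1 / (128 * pi)) \<and>
    (\<forall>j k l. (j, k, l) \<notin> {(1, 1, 1), (1, 2, 2)} \<longrightarrow> c_const A j k l = 0)"
proof -
  have r: "r = (\<lambda>y. 1 + 1/4 * cs y - 1/2 * ss y)"
    by (simp add: fun_eq_iff r_eq ss_def cs_def algebra_simps)
  \<comment> \<open>The lower bound is 1 - 1/4 - 1/2 = 1/4.\<close>
  have r_pos: "0 < r y" for y
    using abs_trig_le_1[of y] by (auto simp: r abs_le_iff)
  have pos: "0 < 1 - 1/2 * ss y" "0 < 1 + 1/2 * ss y" for y
    using abs_trig_le_1[of y] by (auto simp: abs_le_iff)
  have A11: "A y $ 1 $ 1 = inverse (r y) * (1 - 1/2 * ss y)"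
    and A22: "A y $ 2 $ 2 = inverse (r y) * (1 + 1/2 * ss y)"
    and diag: "A y $ 1 $ 2 = 0" "A y $ 2 $ 1 = 0" for y
    by (simp_all add: A_eq ss_def inverse_eq_divide)
  \<comment> \<open>Multiplying by \<open>r\<close> removes the denominator, so all later
    computations involve only trigonometric polynomials.\<close>
  have Ar: "A y $ 1 $ 1 * r y = 1 - 1/2 * ss y" "A y $ 2 $ 2 * r y = 1 + 1/2 * ss y" for y
    using r_pos[of y] by (simp_all add: A11 A22)
  have C2_r: "C2 r"
    unfolding r by (intro C2_add C2_diff C2_mult C2_const C2_trig)
  have per_r: "Y_periodic r"
    unfolding r by (intro Y_periodic_rules Y_periodic_trig)
  have "Y_periodic A"
  proof -
    have "A (y + axis i 1) = A y" for y i
    proof -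
      have "r (y + axis i 1) = r y" "ss (y + axis i 1) = ss y"
        using per_r Y_periodic_trig(1) by (simp_all only: Y_periodic_def)
      then show ?thesis
        by (simp add: vec_eq_iff forall_2 A11 A22 diag)
    qed
    then show ?thesis by (simp add: Y_periodic_def)
  qed
  moreover have "C2 (\<lambda>y. A y $ i $ j)" for i j
  proof -
    have "C2 (\<lambda>y. A y $ 1 $ 1)" "C2 (\<lambda>y. A y $ 2 $ 2)"
      unfolding A11 A22 using r_pos
      by (intro C2_mult C2_add C2_diff C2_inverse C2_const C2_trig C2_r; metis less_irrefl)+
    then show ?thesis
      using exhaust_2[of i] exhaust_2[of j] by (auto simp: diag C2_const)
  qed
  moreover have "sym_pos_def (A y)" for y
  proof -
    have "0 < A y $ 1 $ 1" "0 < A y $ 2 $ 2"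
      using r_pos[of y] pos[of y] by (simp_all only: A11 A22 mult_pos_pos positive_imp_inverse_positive)
    moreover have "x \<bullet> (A y *v x) = A y $ 1 $ 1 * (x $ 1)\<^sup>2 + A y $ 2 $ 2 * (x $ 2)\<^sup>2" for x
      by (simp add: inner_vec_def matrix_vector_mult_def sum_2 diag power2_eq_square algebra_simps)
    ultimately have "0 < x \<bullet> (A y *v x)" if "x \<noteq> 0" for x
      using that by (auto simp: vec_eq_iff forall_2 intro: add_pos_nonneg add_nonneg_pos)
    then show ?thesis
      by (simp add: sym_pos_def_def vec_eq_iff forall_2 transpose_def diag)
  qed
  ultimately have A: "A \<in> C2_torus_spd"
    by (simp add: C2_torus_spd_def)
  \<comment> \<open>The value \<open>b\<close> is left open: the integration rules build it from the
    shape of the integrand, and only an arithmetic identity with \<open>c\<close> remains.\<close>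
  have int: "(f has_integral b) Y \<Longrightarrow> b = c \<Longrightarrow> integral Y f = c" for f :: "real ^ 2 \<Rightarrow> real" and b c
    by (auto dest: integral_unique)
  note has_integral_rules = has_integral_add has_integral_diff has_integral_mult_right
    has_integral_Y_const has_integral_trig
  have inv: "is_invariant_measure A r"
  proof -
    \<comment> \<open>The pure second derivatives of \<open>ss\<close> in the two directions
      coincide, and \<open>ss\<close> enters the two weights with opposite coefficients.\<close>
    have "partial 1 (partial 1 (\<lambda>z. A z $ 1 $ 1 * r z)) y + partial 2 (partial 2 (\<lambda>z. A z $ 2 $ 2 * r z)) y = 0" for y
      unfolding Ar by (simp only: partial_rules C1_add C1_diff C1_mult C1_const C1_trig partial_trig)
        (simp add: algebra_simps)
    moreover have "integral Y r = 1"
      unfolding r by (rule int, (rule has_integral_rules)+, simp)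
    ultimately show ?thesis
      using r_pos by (auto simp: is_invariant_measure_def C2_r per_r sum_2 diag partial_const)
  qed
  have ra: "invariant_measure A = r"
    by (rule invariant_measure_eq[OF A diag inv])
  have eff: "effective_coeff A = mat 1"
  proof -
    \<comment> \<open>The oscillating part of \<open>r A\<close> is a constant matrix times
      \<open>ss\<close>, which has mean zero.\<close>
    define D :: "real ^ 2 ^ 2" where "D = vector [vector [1/2, 0], vector [0, - 1/2]]"
    have "r y *\<^sub>R A y = mat 1 - ss y *\<^sub>R D" for y
      using Ar[of y] by (simp add: D_def vec_eq_iff forall_2 diag mat_def mult.commute)
    moreover have "((\<lambda>y. mat 1 - ss y *\<^sub>R D) has_integral mat 1 - 0 *\<^sub>R D) Y"
      by (intro has_integral_diff has_integral_scaleR_left has_integral_Y_const has_integral_trig)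
    ultimately have "((\<lambda>y. r y *\<^sub>R A y) has_integral mat 1) Y"
      by simp
    then show ?thesis
      by (simp add: effective_coeff_def ra integral_unique)
  qed
  \<comment> \<open>The assumption is the corrector equation multiplied by \<open>r\<close>; the 8
    is the eigenvalue factor 4 times the sum 2 of the two weights.\<close>
  have corr: "corrector A k l = (\<lambda>y. a * cs y + b * ss y)"
    if "\<And>y. 8 * pi\<^sup>2 * (a * cs y + b * ss y) = (A y $ k $ l - mat 1 $ k $ l) * r y" for a b k l
  proof (rule corrector_eq[OF A diag inv])
    let ?v = "\<lambda>y. a * cs y + b * ss y"
    have "- frob (A y) (hessian ?v y) = A y $ k $ l - mat 1 $ k $ l" for y
    proof -
      have "frob (A y) (hessian ?v y) * r y
          = A y $ 1 $ 1 * r y * partial 1 (partial 1 ?v) y + A y $ 2 $ 2 * r y * partial 2 (partial 2 ?v) y"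
        by (simp add: frob_def hessian_def sum_2 diag algebra_simps)
      also have "\<dots> = - (8 * pi\<^sup>2 * ?v y)"
        unfolding Ar partial_partial_trig_combination by (simp add: algebra_simps)
      also have "\<dots> = - (A y $ k $ l - mat 1 $ k $ l) * r y"
        unfolding that by (simp only: minus_mult_left)
      finally show ?thesis
        using r_pos[of y] by simp
    qed
    moreover have "Y_periodic ?v"
      by (intro Y_periodic_rules Y_periodic_trig)
    moreover have "integral Y ?v = 0"
      by (rule int, (rule has_integral_rules)+, simp)
    ultimately show "is_corrector A k l ?v"
      unfolding is_corrector_def eff using C2_trig_combination by blast
  qed
  \<comment> \<open>In direction 1 the derivative of \<open>cs\<close> produces \<open>ss\<close>,
    which pairs with the \<open>ss\<close> in the weight to give \<open>pi * a\<close> times 1/4. In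
    direction 2 the derivatives are \<open>cc\<close> and \<open>sc\<close>, both orthogonal to
    \<open>ss\<close>, so nothing remains.\<close>
  have c: "c_const A 1 k l = pi * a / 4" "c_const A 2 k l = 0"
    if "\<And>y. 8 * pi\<^sup>2 * (a * cs y + b * ss y) = (A y $ k $ l - mat 1 $ k $ l) * r y" for a b k l
  proof -
    let ?v = "\<lambda>y. a * cs y + b * ss y"
    have c_eq: "c_const A j k l = integral Y (\<lambda>y. A y $ j $ j * r y * partial j ?v y)" for j
    proof -
      have "(A y *v axis j 1) \<bullet> grad ?v y * r y = A y $ j $ j * r y * partial j ?v y" for y
        using exhaust_2[of j]
        by (auto simp: matrix_vector_mult_basis column_def grad_def inner_vec_def sum_2 diag)
      then show ?thesis
        by (simp only: c_const_def ra corr[OF that])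
    qed
    have "(1 - 1/2 * ss y) * (- (2 * pi * a) * ss y + 2 * pi * b * cs y)
        = - (2 * pi * a) * ss y + 2 * pi * b * cs y + pi * a * (ss y * ss y) - pi * b * (ss y * cs y)" for y
      by (simp add: algebra_simps)
    then show "c_const A 1 k l = pi * a / 4"
      unfolding c_eq partial_trig_combination Ar
      by (simp only:) (rule int, (rule has_integral_rules)+, simp)
    have "(1 + 1/2 * ss y) * (2 * pi * a * cc y + 2 * pi * b * sc y)
        = 2 * pi * a * cc y + 2 * pi * b * sc y + pi * a * (ss y * cc y) + pi * b * (ss y * sc y)" for y
      by (simp add: algebra_simps)
    then show "c_const A 2 k l = 0"
      unfolding c_eq partial_trig_combination Ar
      by (simp only:) (rule int, (rule has_integral_rules)+, simp)
  qed
  \<comment> \<open>Here the weight minus \<open>r\<close> is \<open>- cs / 4\<close>; dividing by 8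
    pi^2 gives the coefficients.\<close>
  have "8 * pi\<^sup>2 * (- 1 / (32 * pi\<^sup>2) * cs y + 0 * ss y) = (A y $ 1 $ 1 - mat 1 $ 1 $ 1) * r y" for y
    unfolding left_diff_distrib Ar by (simp add: r mat_def)
  note c11 = c[OF this]
  \<comment> \<open>Now the weight minus \<open>r\<close> is \<open>ss - cs / 4\<close>. The
    coefficient of \<open>cs\<close> is the same as before, which is why the two nonzero constants
    agree.\<close>
  have "8 * pi\<^sup>2 * (- 1 / (32 * pi\<^sup>2) * cs y + 1 / (8 * pi\<^sup>2) * ss y) = (A y $ 2 $ 2 - mat 1 $ 2 $ 2) * r y" for y
    unfolding left_diff_distrib Ar by (simp add: r mat_def field_simps)
  note c22 = c[OF this]
  \<comment> \<open>Off the diagonal both \<open>A\<close> and the identity vanish, so the corrector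
    is zero.\<close>
  have "8 * pi\<^sup>2 * (0 * cs y + 0 * ss y) = (A y $ k $ l - mat 1 $ k $ l) * r y" if "k \<noteq> l" for k l y
    using that exhaust_2[of k] exhaust_2[of l] by (auto simp: diag mat_def)
  note c12 = c[OF this]
  have val: "c_const A 1 1 1 = - (1 / (128 * pi))" "c_const A 1 2 2 = - (1 / (128 * pi))"
    unfolding c11 c22 by (simp_all add: power2_eq_square)
  have zero: "c_const A j k l = 0" if "(j, k, l) \<notin> {(1, 1, 1), (1, 2, 2)}" for j k l
    using that exhaust_2[of j] exhaust_2[of k] exhaust_2[of l] c11 c22 c12 by auto
  have "c_const A 1 1 1 \<noteq> 0"
    unfolding val by simp
  with A have "c_bad A"
    unfolding c_bad_def by blast
  with val zero show ?thesis by blast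
qed

end
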